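(* Let $G$ be a $k$-tree and let $\mathbb{S}$ be its set of minimal vertex separators. Then the number of clique trees of $G$ equals $$\prod_{S\in\mathbb{S}}\bigl(\mu(S)+1\bigr)^{\mu(S)-1}.$$
   Context: All graphs are finite and simple. A $k$-tree: $K_{k+1}$ is a $k$-tree, and adding to a $k$-tree a new vertex adjacent exactly to the vertices of a $k$-clique gives a $k$-tree. A minimal vertex separator (mvs) of $G$ is a set $S$ which, for some nonadjacent $u,v$, separates $u$ and $v$ into different components of $G-S$ while no proper subset does. The clique-intersection graph of a connected chordal graph $G$ has the maximal cliques as vertices, edges between intersecting maximal cliques, with weight $|Q\cap Q'|$; a clique tree of $G$ is a maximum-weight spanning tree of it (clique trees are counted as distinct trees on the labeled set of maximal cliques). For any clique tree, the sets $Q\cap Q'$ over its edges are exactly the mvs's and the multiset of them does not depend on the clique tree; the multiplicity $\mu(S)$ is the number of edges $\{Q,Q'\}$ of a clique tree with $Q\cap Q'=S$. *)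

theory Defs
  imports Main
begin

text \<open>An undirected graph is a pair of a vertex set and a set of edges, each edge being the
  two-element set of its endpoints.\<close>

type_synonym 'a graph = "'a set \<times> 'a set set"

abbreviation gverts :: "'a graph \<Rightarrow> 'a set" where
  "gverts G \<equiv> fst G"

abbreviation gedges :: "'a graph \<Rightarrow> 'a set set" where
  "gedges G \<equiv> snd G"

definition finite_simple_graph :: "'a graph \<Rightarrow> bool" where
  "finite_simple_graph G \<longleftrightarrow>
     finite (gverts G) \<and> (\<forall>e\<in>gedges G. e \<subseteq> gverts G \<and> card e = 2)"

definition adjacent :: "'a graph \<Rightarrow> 'a \<Rightarrow> 'a \<Rightarrow> bool" where
  "adjacent G u v \<longleftrightarrow> {u, v} \<in> gedges G"

definition same_component :: "'a graph \<Rightarrow> 'a \<Rightarrow> 'a \<Rightarrow> bool" where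
  "same_component G u v \<longleftrightarrow> u \<in> gverts G \<and> v \<in> gverts G \<and> (adjacent G)\<^sup>*\<^sup>* u v"

definition connected_graph :: "'a graph \<Rightarrow> bool" where
  "connected_graph G \<longleftrightarrow>
     gverts G \<noteq> {} \<and> (\<forall>u\<in>gverts G. \<forall>v\<in>gverts G. same_component G u v)"

definition is_cycle :: "'a graph \<Rightarrow> 'a list \<Rightarrow> bool" where
  "is_cycle G xs \<longleftrightarrow>
     length xs \<ge> 3 \<and> distinct xs \<and> set xs \<subseteq> gverts G \<and>
     (\<forall>i<length xs. adjacent G (xs ! i) (xs ! (Suc i mod length xs)))"

definition is_tree :: "'a graph \<Rightarrow> bool" where
  "is_tree T \<longleftrightarrow> finite_simple_graph T \<and> connected_graph T \<and> (\<nexists>xs. is_cycle T xs)"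

definition is_spanning_tree :: "'a graph \<Rightarrow> 'a graph \<Rightarrow> bool" where
  "is_spanning_tree G T \<longleftrightarrow> is_tree T \<and> gverts T = gverts G \<and> gedges T \<subseteq> gedges G"

definition is_clique :: "'a graph \<Rightarrow> 'a set \<Rightarrow> bool" where
  "is_clique G C \<longleftrightarrow>
     C \<subseteq> gverts G \<and> (\<forall>u\<in>C. \<forall>v\<in>C. u \<noteq> v \<longrightarrow> adjacent G u v)"

definition maximal_clique :: "'a graph \<Rightarrow> 'a set \<Rightarrow> bool" where
  "maximal_clique G Q \<longleftrightarrow> is_clique G Q \<and> (\<nexists>C. is_clique G C \<and> Q \<subset> C)"

definition complete_graph :: "'a set \<Rightarrow> 'a graph" where
  "complete_graph V = (V, {{u, v} |u v. u \<in> V \<and> v \<in> V \<and> u \<noteq> v})"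

inductive k_tree :: "nat \<Rightarrow> 'a graph \<Rightarrow> bool" for k :: nat where
  complete: "card V = k + 1 \<Longrightarrow> k_tree k (complete_graph V)"
| extend: "\<lbrakk>k_tree k G; is_clique G C; card C = k; v \<notin> gverts G\<rbrakk> \<Longrightarrow>
     k_tree k (insert v (gverts G), gedges G \<union> {{u, v} |u. u \<in> C})"

lemma k_tree_finite_simple: "k_tree k G \<Longrightarrow> finite_simple_graph G"
proof (induction rule: k_tree.induct)
  case (complete V)
  then have "finite V"
    using card.infinite by fastforce
  then show ?case
    by (auto simp: finite_simple_graph_def complete_graph_def)
next
  case (extend G C v)
  then show ?case
    unfolding finite_simple_graph_def is_clique_def
    by (fastforce simp: card_2_iff)
qed

definition delete_vertices :: "'a graph \<Rightarrow> 'a set \<Rightarrow> 'a graph" where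
  "delete_vertices G S = (gverts G - S, {e \<in> gedges G. e \<inter> S = {}})"

definition separates :: "'a graph \<Rightarrow> 'a set \<Rightarrow> 'a \<Rightarrow> 'a \<Rightarrow> bool" where
  "separates G S u v \<longleftrightarrow>
     S \<subseteq> gverts G \<and> u \<in> gverts G - S \<and> v \<in> gverts G - S \<and>
     \<not> same_component (delete_vertices G S) u v"

definition minimal_vertex_separator :: "'a graph \<Rightarrow> 'a set \<Rightarrow> bool" where
  "minimal_vertex_separator G S \<longleftrightarrow>
     (\<exists>u v. u \<noteq> v \<and> \<not> adjacent G u v \<and> separates G S u v \<and>
        (\<forall>S'. S' \<subset> S \<longrightarrow> \<not> separates G S' u v))"

definition clique_intersection_graph :: "'a graph \<Rightarrow> 'a set graph" where
  "clique_intersection_graph G =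
     ({Q. maximal_clique G Q},
      {{Q, Q'} |Q Q'. maximal_clique G Q \<and> maximal_clique G Q' \<and> Q \<noteq> Q' \<and> Q \<inter> Q' \<noteq> {}})"

text \<open>For an edge \<^term>\<open>e = {Q, Q'}\<close> of the clique-intersection graph, the intersection of its
  endpoints is \<^term>\<open>\<Inter>e\<close>.\<close>

definition total_weight :: "'a set graph \<Rightarrow> nat" where
  "total_weight T = (\<Sum>e\<in>gedges T. card (\<Inter>e))"

definition clique_tree :: "'a graph \<Rightarrow> 'a set graph \<Rightarrow> bool" where
  "clique_tree G T \<longleftrightarrow>
     is_spanning_tree (clique_intersection_graph G) T \<and>
     (\<forall>T'. is_spanning_tree (clique_intersection_graph G) T' \<longrightarrow>
        total_weight T' \<le> total_weight T)"

text \<open>The multiplicity of a minimal vertex separator, read off from an arbitrary clique tree;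
  for connected chordal graphs the value is independent of the choice.\<close>

definition mvs_multiplicity :: "'a graph \<Rightarrow> 'a set \<Rightarrow> nat" where
  "mvs_multiplicity G S = card {e \<in> gedges (SOME T. clique_tree G T). \<Inter>e = S}"

end

theory Submission
  imports Defs "HOL-Library.FuncSet"
begin

text \<open>The maximal cliques of a \<open>k\<close>-tree have \<open>k + 1\<close> vertices, and the clique trees are the
  spanning trees all of whose edges \<open>{Q, Q'}\<close> satisfy \<open>card (Q \<inter> Q') = k\<close>. Label such an edge by
  \<open>Q \<inter> Q'\<close>. For each \<open>k\<close>-set \<open>S\<close> the cliques containing \<open>S\<close> are pairwise joined by edges labelled
  \<open>S\<close>, and all cliques can be retracted onto them so that every edge with another label
  collapses. Hence an edge set is connected if and only if, for each \<open>S\<close>, its edges labelled \<open>S\<close>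
  connect the cliques containing \<open>S\<close>. As trees are the minimal connected edge sets, a clique tree is
  an independent choice of a tree on the cliques containing \<open>S\<close>, for each \<open>S\<close>; Cayley's formula
  counts these, and \<open>\<mu>(S) + 1\<close> is the number of cliques containing \<open>S\<close>. Sets \<open>S\<close> contained in
  at most one maximal clique contribute the factor 1, so of the minimal vertex separators it
  matters only that they include every \<open>S\<close> contained in two or more.

  Cayley's formula is proved for rooted forests, given by parent maps, by recursion on the set of
  vertices whose parent is a root.\<close>

section \<open>Rooted forests\<close>

lemma sum_Pow_insert:
  assumes "finite A" "z \<notin> A"
  shows "(\<Sum>B\<in>Pow (insert z A). g B) = (\<Sum>B\<in>Pow A. g B) + (\<Sum>B\<in>Pow A. g (insert z B))"
proof -
  have "inj_on (insert z) (Pow A)"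
    using assms(2) by (auto simp: inj_on_def)
  moreover have "Pow A \<inter> insert z ` Pow A = {}"
    using assms(2) by auto
  ultimately show ?thesis
    using assms(1) by (simp add: Pow_insert sum.union_disjoint sum.reindex)
qed

lemma sum_Pow_binomial:
  fixes x y :: "'b::comm_semiring_1"
  assumes "finite A"
  shows "(\<Sum>B\<in>Pow A. x ^ card B * y ^ card (A - B)) = (x + y) ^ card A"
  using assms
proof (induction A rule: finite_induct)
  case (insert z A)
  have "card (insert z A - B) = Suc (card (A - B))" if "B \<in> Pow A" for B
    using that insert.hyps by (subst insert_Diff_if) auto
  moreover have "insert z A - insert z B = A - B" "card (insert z B) = Suc (card B)"
    if "B \<in> Pow A" for B
    using that insert.hyps finite_subset[of B A] by (auto simp: card_insert_if)
  ultimately have "(\<Sum>B\<in>Pow (insert z A). x ^ card B * y ^ card (insert z A - B)) =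
      (\<Sum>B\<in>Pow A. y * (x ^ card B * y ^ card (A - B))) +
      (\<Sum>B\<in>Pow A. x * (x ^ card B * y ^ card (A - B)))"
    unfolding sum_Pow_insert[OF insert.hyps(1,2)]
    by (intro arg_cong2[where f = "(+)"] sum.cong) (auto simp: ac_simps)
  then show ?case
    using insert by (simp add: sum_distrib_left[symmetric] algebra_simps)
qed simp

text \<open>This is \<open>x\<close> times the derivative in \<open>x\<close> of the identity
  \<open>sum_Pow_binomial\<close>, proved the same way: the subsets of \<open>insert z A\<close> are
  split by whether they contain \<open>z\<close>. For empty \<open>A\<close> the factor
  \<open>card A\<close> makes the truncated exponent harmless.\<close>

lemma sum_Pow_card_binomial:
  fixes x y :: nat
  assumes "finite A"
  shows "(\<Sum>B\<in>Pow A. card B * (x ^ card B * y ^ card (A - B))) =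
    card A * x * (x + y) ^ (card A - 1)"
  using assms
proof (induction A rule: finite_induct)
  case (insert z A)
  have "card (insert z A - B) = Suc (card (A - B))" if "B \<in> Pow A" for B
    using that insert.hyps by (subst insert_Diff_if) auto
  moreover have "insert z A - insert z B = A - B" "card (insert z B) = Suc (card B)"
    if "B \<in> Pow A" for B
    using that insert.hyps finite_subset[of B A] by (auto simp: card_insert_if)
  ultimately have "(\<Sum>B\<in>Pow (insert z A). card B * (x ^ card B * y ^ card (insert z A - B))) =
      (\<Sum>B\<in>Pow A. y * (card B * (x ^ card B * y ^ card (A - B)))) +
      (\<Sum>B\<in>Pow A. x * (card B * (x ^ card B * y ^ card (A - B))) +
        x * (x ^ card B * y ^ card (A - B)))"
    unfolding sum_Pow_insert[OF insert.hyps(1,2)]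
    by (intro arg_cong2[where f = "(+)"] sum.cong) (auto simp: algebra_simps)
  also have "\<dots> = (x + y) * (card A * x * (x + y) ^ (card A - 1)) + x * (x + y) ^ card A"
    by (simp add: sum_distrib_left[symmetric] sum.distrib insert.IH sum_Pow_binomial insert.hyps
        algebra_simps)
  also have "\<dots> = Suc (card A) * x * (x + y) ^ card A"
    by (cases "card A") (simp_all add: algebra_simps)
  finally show ?case
    using insert.hyps by simp
qed simp

section \<open>Counting rooted forests by the children of the roots\<close>

text \<open>Parent maps of forests with root set \<open>R\<close>. Acyclicity is stated as: no
  nonempty part of \<open>A\<close> is closed under \<open>f\<close>. Applied to singletons, pairs
  or sets of counterexamples, this replaces inductions along paths to a root.\<close>

definition forest_maps :: "'a set \<Rightarrow> 'a set \<Rightarrow> ('a \<Rightarrow> 'a) set" where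
  "forest_maps A R =
    {f \<in> A \<rightarrow>\<^sub>E A \<union> R. \<forall>X\<subseteq>A. X \<noteq> {} \<longrightarrow> (\<exists>x\<in>X. f x \<notin> X)}"

lemma forest_maps_escape:
  "f \<in> forest_maps A R \<Longrightarrow> X \<subseteq> A \<Longrightarrow> X \<noteq> {} \<Longrightarrow> \<exists>x\<in>X. f x \<notin> X"
  by (simp add: forest_maps_def)

lemma forest_maps_range: "f \<in> forest_maps A R \<Longrightarrow> x \<in> A \<Longrightarrow> f x \<in> A \<union> R"
  using PiE_mem[of f A "\<lambda>_. A \<union> R" x] by (simp add: forest_maps_def)

lemma finite_forest_maps: "finite A \<Longrightarrow> finite R \<Longrightarrow> finite (forest_maps A R)"
  unfolding forest_maps_def by (rule finite_Collect_conjI) (auto simp: finite_PiE)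

text \<open>The children \<open>B\<close> of the roots choose their parents freely in
  \<open>R\<close>. No other vertex has its parent in \<open>R\<close>, so what remains is a forest
  on \<open>A - B\<close> rooted at the elements of \<open>B\<close>.\<close>

lemma card_forest_maps_first_level:
  assumes "A \<inter> R = {}" "B \<subseteq> A" "finite A"
  shows "card {f \<in> forest_maps A R. {a\<in>A. f a \<in> R} = B} =
    card R ^ card B * card (forest_maps (A - B) B)"
proof -
  have "bij_betw (\<lambda>f. (restrict f B, restrict f (A - B)))
      {f \<in> forest_maps A R. {a\<in>A. f a \<in> R} = B} ((B \<rightarrow>\<^sub>E R) \<times> forest_maps (A - B) B)"
  proof (rule bij_betw_byWitness[where f' = "\<lambda>(g, h) x. if x \<in> B then g x else h x"])
    show "\<forall>f\<in>{f \<in> forest_maps A R. {a\<in>A. f a \<in> R} = B}.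
        (\<lambda>(g, h) x. if x \<in> B then g x else h x) (restrict f B, restrict f (A - B)) = f"
    proof
      fix f assume "f \<in> {f \<in> forest_maps A R. {a\<in>A. f a \<in> R} = B}"
      then have "f x = undefined" if "x \<notin> A" for x
        using that PiE_arb[of f A _ x] by (auto simp: forest_maps_def)
      then show "(\<lambda>(g, h) x. if x \<in> B then g x else h x) (restrict f B, restrict f (A - B)) = f"
        by (intro ext) (auto simp: restrict_def)
    qed
    show "\<forall>p\<in>(B \<rightarrow>\<^sub>E R) \<times> forest_maps (A - B) B.
        (restrict ((\<lambda>(g, h) x. if x \<in> B then g x else h x) p) B,
         restrict ((\<lambda>(g, h) x. if x \<in> B then g x else h x) p) (A - B)) = p"
    proof
      fix p assume "p \<in> (B \<rightarrow>\<^sub>E R) \<times> forest_maps (A - B) B"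
      then obtain g h where p: "p = (g, h)" and g: "g \<in> B \<rightarrow>\<^sub>E R"
        and h: "h \<in> forest_maps (A - B) B"
        by auto
      have "restrict (\<lambda>x. if x \<in> B then g x else h x) B x = g x"
        "restrict (\<lambda>x. if x \<in> B then g x else h x) (A - B) x = h x" for x
        using PiE_arb[OF g, of x] PiE_arb[of h "A - B" _ x] h by (auto simp: forest_maps_def)
      then show "(restrict ((\<lambda>(g, h) x. if x \<in> B then g x else h x) p) B,
         restrict ((\<lambda>(g, h) x. if x \<in> B then g x else h x) p) (A - B)) = p"
        unfolding p by (simp add: fun_eq_iff)
    qed
    show "(\<lambda>f. (restrict f B, restrict f (A - B))) `
        {f \<in> forest_maps A R. {a\<in>A. f a \<in> R} = B} \<subseteq> (B \<rightarrow>\<^sub>E R) \<times> forest_maps (A - B) B"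
    proof (rule image_subsetI)
      fix f assume "f \<in> {f \<in> forest_maps A R. {a\<in>A. f a \<in> R} = B}"
      then have f: "f \<in> forest_maps A R" and B: "B = {a\<in>A. f a \<in> R}"
        by auto
      have "restrict f B \<in> B \<rightarrow>\<^sub>E R"
        using B by auto
      moreover have "f \<in> A \<rightarrow> A \<union> R"
        using f by (auto simp: forest_maps_def)
      moreover have "\<exists>x\<in>X. restrict f (A - B) x \<notin> X" if "X \<subseteq> A - B" "X \<noteq> {}" for X
      proof -
        have "\<exists>x\<in>X. f x \<notin> X"
          using that by (intro forest_maps_escape[OF f]) auto
        then show ?thesis
          using that by auto
      qed
      ultimately show "(restrict f B, restrict f (A - B)) \<in> (B \<rightarrow>\<^sub>E R) \<times> forest_maps (A - B) B"
        using B by (auto simp: forest_maps_def)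
    qed
    show "(\<lambda>(g, h) x. if x \<in> B then g x else h x) ` ((B \<rightarrow>\<^sub>E R) \<times> forest_maps (A - B) B)
        \<subseteq> {f \<in> forest_maps A R. {a\<in>A. f a \<in> R} = B}"
    proof (rule image_subsetI)
      fix p assume "p \<in> (B \<rightarrow>\<^sub>E R) \<times> forest_maps (A - B) B"
      then obtain g h where p: "p = (g, h)" and g: "g \<in> B \<rightarrow>\<^sub>E R"
        and h: "h \<in> forest_maps (A - B) B"
        by auto
      let ?f = "\<lambda>x. if x \<in> B then g x else h x"
      have hA: "h x \<in> A" if "x \<in> A - B" for x
        using forest_maps_range[OF h that] assms(2) by auto
      have "?f \<in> A \<rightarrow>\<^sub>E A \<union> R"
        using g h hA assms(2) by (auto simp: forest_maps_def PiE_def Pi_def extensional_def)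
      \<comment> \<open>A set meeting \<open>B\<close> is left there, since \<open>g\<close> maps
        \<open>B\<close> into \<open>R\<close>, which is disjoint from \<open>A\<close>; a set
        avoiding \<open>B\<close> is left by \<open>h\<close>.\<close>
      moreover have "\<exists>x\<in>X. ?f x \<notin> X" if X: "X \<subseteq> A" "X \<noteq> {}" for X
      proof (cases "X \<inter> B = {}")
        case True
        then have "\<exists>x\<in>X. h x \<notin> X"
          using X by (intro forest_maps_escape[OF h]) auto
        then show ?thesis
          using True by auto
      next
        case False
        then obtain x where "x \<in> X" "x \<in> B"
          by auto
        then show ?thesis
          using g X assms(1) by (intro bexI[of _ x]) auto
      qed
      moreover have "{a\<in>A. ?f a \<in> R} = B"
        using g hA assms by auto
      ultimately show "(\<lambda>(g, h) x. if x \<in> B then g x else h x) p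
          \<in> {f \<in> forest_maps A R. {a\<in>A. f a \<in> R} = B}"
        unfolding p prod.case forest_maps_def mem_Collect_eq by blast
    qed
  qed
  then have "card {f \<in> forest_maps A R. {a\<in>A. f a \<in> R} = B} =
      card ((B \<rightarrow>\<^sub>E R) \<times> forest_maps (A - B) B)"
    by (rule bij_betw_same_card)
  then show ?thesis
    using assms finite_subset[of B A] by (simp add: card_cartesian_product card_funcsetE)
qed

text \<open>Multiplying by the total number of vertices keeps the formula valid for empty
  \<^term>\<open>A\<close>, where \<open>card R * (card A + card R) ^ (card A - 1)\<close> would be wrong.\<close>

lemma card_forest_maps:
  assumes "finite A" "finite R" "A \<inter> R = {}"
  shows "card (forest_maps A R) * (card A + card R) = card R * (card A + card R) ^ card A"
  using assms
proof (induction "card A" arbitrary: A R rule: less_induct)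
  case less
  show ?case
  proof (cases "A = {}")
    case True
    then have "forest_maps A R = {\<lambda>_. undefined}"
      by (auto simp: forest_maps_def)
    with True show ?thesis
      by simp
  next
    case False
    then have pos: "card A > 0"
      using less.prems by (simp add: card_gt_0_iff)
    \<comment> \<open>The factor \<open>card A\<close> is the one in the induction hypothesis for
      \<open>A - B\<close> with roots \<open>B\<close>, whose total number of vertices is
      \<open>card (A - B) + card B = card A\<close>.\<close>
    have fib: "card {f \<in> forest_maps A R. {a\<in>A. f a \<in> R} = B} * card A =
        card B * (card R ^ card B * card A ^ card (A - B))" if B: "B \<in> Pow A" for B
    proof (cases "B = {}")
      case True
      \<comment> \<open>The set \<open>A\<close> itself is not closed under \<open>f\<close>, so
        some vertex is a child of a root.\<close>
      have "f \<in> forest_maps A R \<Longrightarrow> {a\<in>A. f a \<in> R} \<noteq> {}" for f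
        using forest_maps_escape[of f A R A] forest_maps_range[of f A R] False by blast
      then have "{f \<in> forest_maps A R. {a\<in>A. f a \<in> R} = B} = {}"
        using True by auto
      then show ?thesis
        using True by (simp only: card.empty)
    next
      case B0: False
      have fB: "finite B"
        using B less.prems(1) finite_subset by auto
      have "card (A - B) < card A"
        using B B0 less.prems(1) by (intro psubset_card_mono) auto
      moreover have "card (A - B) + card B = card A"
        using B fB less.prems(1) by (simp add: card_Diff_subset card_mono)
      ultimately have "card (forest_maps (A - B) B) * card A = card B * card A ^ card (A - B)"
        using less.hyps[of "A - B" B] less.prems(1) fB by auto
      then show ?thesis
        using card_forest_maps_first_level[OF less.prems(3) _ less.prems(1), of B] B
        by (simp add: ac_simps)
    qed
    have "(\<lambda>f. {a\<in>A. f a \<in> R}) ` forest_maps A R \<subseteq> Pow A"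
      by auto
    then have "card (forest_maps A R) =
        (\<Sum>B\<in>Pow A. card {f \<in> forest_maps A R. {a\<in>A. f a \<in> R} = B})"
      using sum.group[of "forest_maps A R" "Pow A" "\<lambda>f. {a\<in>A. f a \<in> R}" "\<lambda>_. 1::nat"]
        less.prems(1) finite_forest_maps[OF less.prems(1,2)] by simp
    then have "card (forest_maps A R) * card A =
        (\<Sum>B\<in>Pow A. card B * (card R ^ card B * card A ^ card (A - B)))"
      by (simp add: sum_distrib_right fib)
    also have "\<dots> = card A * (card R * (card R + card A) ^ (card A - 1))"
      by (simp add: sum_Pow_card_binomial less.prems)
    finally have "card (forest_maps A R) = card R * (card R + card A) ^ (card A - 1)"
      using pos by simp
    then show ?thesis
      using pos by (cases "card A") (simp_all add: algebra_simps)
  qed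
qed

section \<open>Spanning trees as minimal connected edge sets\<close>

definition linked :: "'a set set \<Rightarrow> 'a \<Rightarrow> 'a \<Rightarrow> bool" where
  "linked E = (\<lambda>u v. {u, v} \<in> E)\<^sup>*\<^sup>*"

definition links :: "'a set \<Rightarrow> 'a set set \<Rightarrow> bool" where
  "links V E \<longleftrightarrow> (\<forall>u\<in>V. \<forall>v\<in>V. linked E u v)"

definition edges_on :: "'a set \<Rightarrow> 'a set set" where
  "edges_on V = {e. e \<subseteq> V \<and> card e = 2}"

text \<open>Minimality of a connected edge set is used in place of acyclicity, because connectedness
  splits along labels and minimality then splits with it. The two notions are identified in
  \<open>is_tree_iff_spanning_trees\<close>.\<close>

definition spanning_trees :: "'a set \<Rightarrow> 'a set set set" where
  "spanning_trees V = {E. E \<subseteq> edges_on V \<and> links V E \<and> (\<forall>e\<in>E. \<not> links V (E - {e}))}"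

lemma linked_refl [simp]: "linked E u u"
  by (simp add: linked_def)

lemma linked_edge: "{u, v} \<in> E \<Longrightarrow> linked E u v"
  by (auto simp: linked_def)

lemma linked_trans: "linked E u v \<Longrightarrow> linked E v w \<Longrightarrow> linked E u w"
  by (simp add: linked_def)

lemma linked_induct [consumes 1, case_names refl step]:
  assumes "linked E u v" "P u" "\<And>v w. linked E u v \<Longrightarrow> {v, w} \<in> E \<Longrightarrow> P v \<Longrightarrow> P w"
  shows "P v"
  using assms unfolding linked_def by (induction rule: rtranclp_induct) auto

text \<open>Walks are transported along a vertex map \<open>h\<close> that may collapse edges. The
  identity gives monotonicity; a retraction onto the cliques over a face gives the decomposition by
  labels.\<close>

lemma linked_if_edges_linked:
  assumes "linked E u v" "\<And>x y. {x, y} \<in> E \<Longrightarrow> linked F (h x) (h y)"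
  shows "linked F (h u) (h v)"
  using assms(1)
proof (induction rule: linked_induct)
  case (step v w)
  then show ?case
    using assms(2) linked_trans by metis
qed simp

lemma linked_mono: "linked E u v \<Longrightarrow> E \<subseteq> F \<Longrightarrow> linked F u v"
  using linked_if_edges_linked[of E u v F "\<lambda>x. x"] linked_edge[of _ _ F] by auto

lemma linked_sym: "linked E u v \<Longrightarrow> linked E v u"
proof (induction rule: linked_induct)
  case (step v w)
  then show ?case
    using linked_trans[OF linked_edge[of w v E]] by (simp add: insert_commute)
qed simp

lemma links_if_edges_linked:
  assumes "links V E" "\<And>x y. {x, y} \<in> E \<Longrightarrow> linked F x y"
  shows "links V F"
  using assms linked_if_edges_linked[of E _ _ F "\<lambda>x. x"] unfolding links_def by blast

lemma links_mono: "links V E \<Longrightarrow> E \<subseteq> F \<Longrightarrow> links V F"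
  using linked_mono unfolding links_def by metis

lemma finite_edges_on: "finite V \<Longrightarrow> finite (edges_on V)"
  unfolding edges_on_def by (rule finite_subset[of _ "Pow V"]) auto

lemma edges_onD: "{u, v} \<in> edges_on V \<Longrightarrow> u \<in> V \<and> v \<in> V \<and> u \<noteq> v"
  by (auto simp: edges_on_def card_2_iff doubleton_eq_iff)

lemma edges_on_iff: "e \<in> edges_on V \<longleftrightarrow> (\<exists>u v. e = {u, v} \<and> u \<in> V \<and> v \<in> V \<and> u \<noteq> v)"
  by (auto simp: edges_on_def card_2_iff)

section \<open>Trees as sets of parent edges\<close>

definition parent_edges :: "'a set \<Rightarrow> ('a \<Rightarrow> 'a) \<Rightarrow> 'a set set" where
  "parent_edges A f = (\<lambda>x. {x, f x}) ` A"

lemma forest_maps_no_fixpoint: "f \<in> forest_maps A R \<Longrightarrow> x \<in> A \<Longrightarrow> f x \<noteq> x"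
  using forest_maps_escape[of f A R "{x}"] by auto

lemma forest_maps_no_2cycle:
  "f \<in> forest_maps A R \<Longrightarrow> x \<in> A \<Longrightarrow> f x \<in> A \<Longrightarrow> f (f x) \<noteq> x"
  using forest_maps_escape[of f A R "{x, f x}"] by auto

text \<open>Two vertices yielding the same edge would be each other's parents, a closed
  pair.\<close>

lemma card_parent_edges:
  assumes "f \<in> forest_maps A R"
  shows "card (parent_edges A f) = card A"
proof -
  have "inj_on (\<lambda>x. {x, f x}) A"
    using forest_maps_no_2cycle[OF assms] by (fastforce simp: inj_on_def doubleton_eq_iff)
  then show ?thesis
    by (simp add: parent_edges_def card_image)
qed

lemma parent_edges_subset:
  assumes "f \<in> forest_maps (V - {r}) {r}" "r \<in> V"
  shows "parent_edges (V - {r}) f \<subseteq> edges_on V"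
proof -
  have "f x \<in> V" "x \<noteq> f x" if "x \<in> V - {r}" for x
    using forest_maps_range[OF assms(1) that] forest_maps_no_fixpoint[OF assms(1) that] assms(2)
    by auto
  then show ?thesis
    by (auto simp: parent_edges_def edges_on_def)
qed

text \<open>If the set where \<open>f\<close> and \<open>g\<close> differ is nonempty,
  \<open>f\<close> leaves it at some \<open>x\<close>. The edge \<open>{x, f x}\<close> must arise
  in \<open>g\<close> from \<open>f x\<close>, so \<open>g (f x) = x\<close>; as the maps agree at
  \<open>f x\<close>, this is a 2-cycle of \<open>f\<close>.\<close>

lemma inj_on_parent_edges:
  assumes "r \<notin> A"
  shows "inj_on (parent_edges A) (forest_maps A {r})"
proof (rule inj_onI)
  fix f g assume f: "f \<in> forest_maps A {r}" and g: "g \<in> forest_maps A {r}"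
    and eq: "parent_edges A f = parent_edges A g"
  have "{x\<in>A. f x \<noteq> g x} = {}"
  proof (rule ccontr)
    assume "{x\<in>A. f x \<noteq> g x} \<noteq> {}"
    then obtain x where x: "x \<in> A" "f x \<noteq> g x" "f x \<notin> {x\<in>A. f x \<noteq> g x}"
      using forest_maps_escape[OF f, of "{x\<in>A. f x \<noteq> g x}"] by blast
    have "{x, f x} \<in> parent_edges A g"
      using x(1) unfolding eq[symmetric] by (auto simp: parent_edges_def)
    then obtain y where "y \<in> A" "{x, f x} = {y, g y}"
      by (auto simp: parent_edges_def)
    then have "f x \<in> A" "g (f x) = x"
      using x(2) by (auto simp: doubleton_eq_iff)
    then have "f (f x) = x"
      using x(3) by auto
    then show False
      using forest_maps_no_2cycle[OF f x(1) \<open>f x \<in> A\<close>] by simp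
  qed
  then have "f x = g x" if "x \<in> A" for x
    using that by auto
  then show "f = g"
    using f g PiE_ext[of f A "\<lambda>_. A \<union> {r}" g] by (simp add: forest_maps_def)
qed

text \<open>Otherwise the vertices not linked to \<open>r\<close> would be a nonempty set closed
  under the parent map.\<close>

lemma links_parent_edges:
  assumes f: "f \<in> forest_maps (V - {r}) {r}"
  shows "links V (parent_edges (V - {r}) f)"
proof -
  let ?E = "parent_edges (V - {r}) f"
  have "{x\<in>V - {r}. \<not> linked ?E x r} = {}"
  proof (rule ccontr)
    assume "{x\<in>V - {r}. \<not> linked ?E x r} \<noteq> {}"
    then obtain x where x: "x \<in> V - {r}" "\<not> linked ?E x r"
      and fx: "f x \<notin> {x\<in>V - {r}. \<not> linked ?E x r}"
      using forest_maps_escape[OF f, of "{x\<in>V - {r}. \<not> linked ?E x r}"] by blast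
    have "linked ?E (f x) r"
      using fx forest_maps_range[OF f x(1)] by auto
    moreover have "linked ?E x (f x)"
      using x(1) by (intro linked_edge) (auto simp: parent_edges_def)
    ultimately show False
      using x(2) linked_trans by metis
  qed
  then have "linked ?E x r" if "x \<in> V" for x
    using that by (cases "x = r") auto
  then show ?thesis
    unfolding links_def using linked_trans linked_sym by metis
qed

text \<open>A shortest-path tree rooted at \<^term>\<open>r\<close>.\<close>

lemma links_contains_parent_edges:
  assumes "links V E" "E \<subseteq> edges_on V" "r \<in> V"
  obtains f where "f \<in> forest_maps (V - {r}) {r}" "parent_edges (V - {r}) f \<subseteq> E"
proof -
  define R where "R = (\<lambda>u v. {u, v} \<in> E)"
  define d where "d x = (LEAST n. (R ^^ n) r x)" for x
  \<comment> \<open>The parent of \<open>x\<close> is the last vertex before \<open>x\<close> on a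
    shortest walk from \<open>r\<close>.\<close>
  have "\<exists>y. y \<in> V \<and> {x, y} \<in> E \<and> d y < d x" if x: "x \<in> V - {r}" for x
  proof -
    have "R\<^sup>*\<^sup>* r x"
      using x assms(1,3) by (auto simp: links_def linked_def R_def)
    then obtain n where "(R ^^ n) r x"
      by (auto simp: rtranclp_power)
    then have dx: "(R ^^ d x) r x"
      unfolding d_def by (rule LeastI)
    with x obtain m where m: "d x = Suc m"
      by (cases "d x") auto
    with dx obtain y where y: "(R ^^ m) r y" "R y x"
      by auto
    then have "d y \<le> m"
      unfolding d_def by (intro Least_le)
    moreover have "y \<in> V" "{x, y} \<in> E"
      using y(2) assms(2) edges_onD[of y x V] by (auto simp: R_def insert_commute)
    ultimately show ?thesis
      using m by auto
  qed
  then obtain p where p: "\<And>x. x \<in> V - {r} \<Longrightarrow> p x \<in> V \<and> {x, p x} \<in> E \<and> d (p x) < d x"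
    by metis
  let ?f = "restrict p (V - {r})"
  \<comment> \<open>A point of \<open>X\<close> nearest to \<open>r\<close> has its parent outside
    \<open>X\<close>.\<close>
  have "\<exists>x\<in>X. ?f x \<notin> X" if X: "X \<subseteq> V - {r}" and "X \<noteq> {}" for X
  proof -
    obtain x where x: "x \<in> X" "\<forall>y. y \<in> X \<longrightarrow> d x \<le> d y"
      using ex_has_least_nat[of "\<lambda>x. x \<in> X" _ d] \<open>X \<noteq> {}\<close> by blast
    then have "p x \<notin> X"
      using p[of x] X by force
    then show ?thesis
      using x(1) X by auto
  qed
  then have "?f \<in> forest_maps (V - {r}) {r}"
    using p unfolding forest_maps_def by auto
  moreover have "parent_edges (V - {r}) ?f \<subseteq> E"
    using p by (auto simp: parent_edges_def)
  ultimately show ?thesis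
    using that by blast
qed

text \<open>A minimal connected edge set contains parent edges, which are connected already, so it
  equals them. Conversely, if parent edges stayed connected after losing an edge, they would
  properly contain another set of parent edges, but all these sets have the same size.\<close>

lemma spanning_trees_eq_parent_edges:
  assumes "finite V" "r \<in> V"
  shows "spanning_trees V = parent_edges (V - {r}) ` forest_maps (V - {r}) {r}"
proof (intro equalityI subsetI)
  fix E assume E: "E \<in> spanning_trees V"
  then obtain f where f: "f \<in> forest_maps (V - {r}) {r}" "parent_edges (V - {r}) f \<subseteq> E"
    using links_contains_parent_edges[of V E r] assms(2) by (auto simp: spanning_trees_def)
  have "E \<subseteq> parent_edges (V - {r}) f"
  proof
    fix e assume "e \<in> E"
    then have "\<not> links V (E - {e})"
      using E by (auto simp: spanning_trees_def)
    then show "e \<in> parent_edges (V - {r}) f"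
      using links_mono[OF links_parent_edges[OF f(1)], of "E - {e}"] f(2) by auto
  qed
  with f show "E \<in> parent_edges (V - {r}) ` forest_maps (V - {r}) {r}"
    by auto
next
  fix E assume "E \<in> parent_edges (V - {r}) ` forest_maps (V - {r}) {r}"
  then obtain f where f: "f \<in> forest_maps (V - {r}) {r}" and E: "E = parent_edges (V - {r}) f"
    by auto
  have sub: "E \<subseteq> edges_on V"
    using parent_edges_subset[OF f assms(2)] E by simp
  have "\<not> links V (E - {e})" if "e \<in> E" for e
  proof
    assume "links V (E - {e})"
    then obtain g where g: "g \<in> forest_maps (V - {r}) {r}" "parent_edges (V - {r}) g \<subseteq> E - {e}"
      using links_contains_parent_edges[of V "E - {e}" r] assms(2) sub by auto
    have "finite E"
      using E assms(1) by (auto simp: parent_edges_def)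
    then have "card (parent_edges (V - {r}) g) < card E"
      using g(2) that by (intro psubset_card_mono) auto
    then show False
      using card_parent_edges[OF f] card_parent_edges[OF g(1)] E by simp
  qed
  then show "E \<in> spanning_trees V"
    using sub links_parent_edges[OF f] E by (auto simp: spanning_trees_def)
qed

text \<open>Once a root \<open>r\<close> is fixed, trees correspond to parent maps with
  \<open>r\<close> as the only root.\<close>

theorem Cayley_formula:
  assumes "finite V" "V \<noteq> {}"
  shows "card (spanning_trees V) = card V ^ (card V - 2)"
proof -
  obtain r where r: "r \<in> V"
    using assms(2) by auto
  then have n: "card (V - {r}) + card {r} = card V"
    using assms(1) card.remove by fastforce
  have "card (spanning_trees V) * card V = card V ^ (card V - 1)"
    using card_forest_maps[of "V - {r}" "{r}"] assms(1) r n[unfolded n]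
    unfolding n spanning_trees_eq_parent_edges[OF assms(1) r]
    by (simp add: card_image inj_on_parent_edges)
  moreover have "card V > 0"
    using assms by (simp add: card_gt_0_iff)
  ultimately show ?thesis
    \<comment> \<open>The case \<open>card V = 1\<close> is separate because
      \<open>card V - 2\<close> is then truncated to 0.\<close>
    by (cases "card V - 1") (auto simp: numeral_2_eq_2 Suc_diff_Suc)
qed

lemma card_spanning_tree:
  assumes "finite V" "V \<noteq> {}" "E \<in> spanning_trees V"
  shows "card E = card V - 1"
proof -
  obtain r where "r \<in> V"
    using assms(2) by auto
  then show ?thesis
    using assms card_parent_edges[of _ "V - {r}" "{r}"]
    by (auto simp: spanning_trees_eq_parent_edges)
qed

lemma links_contains_spanning_tree:
  assumes "finite V" "V \<noteq> {}" "links V E" "E \<subseteq> edges_on V"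
  shows "\<exists>T\<in>spanning_trees V. T \<subseteq> E"
proof -
  obtain r where "r \<in> V"
    using assms(2) by auto
  then show ?thesis
    using assms links_contains_parent_edges[of V E r] spanning_trees_eq_parent_edges[of V r]
    by (metis imageI)
qed

section \<open>Minimal connected edge sets are the acyclic ones\<close>

lemma linked_distinct_path:
  assumes "linked E u v"
  shows "\<exists>xs. xs \<noteq> [] \<and> hd xs = u \<and> last xs = v \<and> distinct xs \<and>
    (\<forall>i. Suc i < length xs \<longrightarrow> {xs ! i, xs ! Suc i} \<in> E)"
  using assms
proof (induction rule: linked_induct)
  case refl
  show ?case
    by (rule exI[of _ "[u]"]) simp
next
  case (step v w)
  then obtain xs where xs: "xs \<noteq> []" "hd xs = u" "last xs = v" "distinct xs"
    and E: "\<And>i. Suc i < length xs \<Longrightarrow> {xs ! i, xs ! Suc i} \<in> E"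
    by auto
  show ?case
  proof (cases "w \<in> set xs")
    \<comment> \<open>A walk returning to \<open>w\<close> is cut back to the earlier occurrence of
      \<open>w\<close>.\<close>
    case True
    then obtain j where "j < length xs" "xs ! j = w"
      by (auto simp: in_set_conv_nth)
    then show ?thesis
      using xs E by (intro exI[of _ "take (Suc j) xs"]) (auto simp: last_conv_nth)
  next
    case False
    have "{(xs @ [w]) ! i, (xs @ [w]) ! Suc i} \<in> E" if i: "Suc i < length (xs @ [w])" for i
    proof (cases "Suc i < length xs")
      case False
      then have "i = length xs - 1" "Suc i = length xs"
        using i xs(1) by auto
      then show ?thesis
        using step.hyps(2) xs(1,3) by (simp add: nth_append last_conv_nth)
    qed (use E in \<open>simp add: nth_append\<close>)
    then show ?thesis
      using xs False by (intro exI[of _ "xs @ [w]"]) auto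
  qed
qed

lemma linked_adjacent: "(adjacent (V, E))\<^sup>*\<^sup>* = linked E"
  by (simp add: linked_def adjacent_def[abs_def])

lemma connected_graph_iff_links: "connected_graph (V, E) \<longleftrightarrow> V \<noteq> {} \<and> links V E"
  by (simp add: connected_graph_def same_component_def links_def linked_adjacent)

text \<open>The rest of the cycle links the two ends of its closing edge \<open>e\<close>.\<close>

lemma cycle_edge_redundant:
  assumes "is_cycle (V, E) xs" "links V E"
  shows "\<exists>e\<in>E. links V (E - {e})"
proof -
  define n where "n = length xs"
  have n: "n \<ge> 3" and xs: "distinct xs"
    and E: "\<And>i. i < n \<Longrightarrow> {xs ! i, xs ! (Suc i mod n)} \<in> E"
    using assms(1) by (auto simp: is_cycle_def adjacent_def n_def)
  define e where "e = {xs ! (n - 1), xs ! 0}"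
  have e: "e \<in> E"
    using E[of "n - 1"] n by (simp add: e_def)
  have path: "linked (E - {e}) (xs ! 0) (xs ! i)" if "i < n" for i
    using that
  proof (induction i)
    case (Suc i)
    \<comment> \<open>The step from the first vertex to the last would be \<open>e\<close> only for
      \<open>n = 2\<close>.\<close>
    have "{xs ! i, xs ! Suc i} \<noteq> e"
    proof
      assume "{xs ! i, xs ! Suc i} = e"
      then have "xs ! i = xs ! (n - 1) \<or> xs ! i = xs ! 0 \<and> xs ! Suc i = xs ! (n - 1)"
        by (auto simp: e_def doubleton_eq_iff)
      then have "i = n - 1 \<or> i = 0 \<and> Suc i = n - 1"
        using nth_eq_iff_index_eq[OF xs, of i "n - 1"] nth_eq_iff_index_eq[OF xs, of i 0]
          nth_eq_iff_index_eq[OF xs, of "Suc i" "n - 1"] Suc.prems n n_def by linarith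
      then show False
        using Suc.prems n by linarith
    qed
    then have "linked (E - {e}) (xs ! i) (xs ! Suc i)"
      using E[of i] Suc.prems by (intro linked_edge) auto
    then show ?case
      using Suc linked_trans by (metis Suc_lessD)
  qed simp
  have "linked (E - {e}) x y" if "{x, y} \<in> E" for x y
  proof (cases "{x, y} = e")
    case True
    then have "x = xs ! 0 \<and> y = xs ! (n - 1) \<or> x = xs ! (n - 1) \<and> y = xs ! 0"
      by (auto simp: e_def doubleton_eq_iff)
    then show ?thesis
      using path[of "n - 1"] n linked_sym by fastforce
  next
    case False
    then show ?thesis
      using that by (intro linked_edge) auto
  qed
  then have "links V (E - {e})"
    using assms(2) links_if_edges_linked by metis
  with e show ?thesis
    by blast
qed

text \<open>The ends of \<open>e\<close> are joined by a path without repetitions that avoids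
  \<open>e\<close>; adding \<open>e\<close> closes it to a cycle.\<close>

lemma redundant_edge_cycle:
  assumes "E \<subseteq> edges_on V" "e \<in> E" "links V (E - {e})"
  shows "\<exists>xs. is_cycle (V, E) xs"
proof -
  obtain u v where e: "e = {u, v}" and uv: "u \<in> V" "v \<in> V" "u \<noteq> v"
    using assms(1,2) edges_on_iff[of e V] by blast
  have "linked (E - {e}) u v"
    using assms(3) uv by (simp add: links_def)
  then obtain xs where xs: "xs \<noteq> []" "hd xs = u" "last xs = v" "distinct xs"
    and E: "\<And>i. Suc i < length xs \<Longrightarrow> {xs ! i, xs ! Suc i} \<in> E - {e}"
    using linked_distinct_path[of "E - {e}" u v] by blast
  have ends: "xs ! 0 = u" "xs ! (length xs - 1) = v"
    using xs by (auto simp: hd_conv_nth last_conv_nth)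
  \<comment> \<open>Length 1 would identify the ends of \<open>e\<close>, and length 2 would make
    the path use \<open>e\<close>.\<close>
  have "length xs \<noteq> 1"
    using ends uv(3) by auto
  moreover have "length xs \<noteq> 2"
    using E[of 0] ends e by auto
  ultimately have len: "length xs \<ge> 3"
    using xs(1) by (cases "length xs") auto
  have "adjacent (V, E) (xs ! i) (xs ! (Suc i mod length xs))" if "i < length xs" for i
  proof (cases "Suc i < length xs")
    case True
    then show ?thesis
      using E[of i] by (simp add: adjacent_def)
  next
    case False
    then have "Suc i = length xs" "i = length xs - 1"
      using that by auto
    then show ?thesis
      using ends e assms(2) by (simp add: adjacent_def insert_commute)
  qed
  moreover from this have "set xs \<subseteq> V"
    using assms(1) unfolding in_set_conv_nth subset_iff adjacent_def
    by (metis edges_onD snd_conv)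
  ultimately have "is_cycle (V, E) xs"
    using xs(4) len by (simp add: is_cycle_def)
  then show ?thesis ..
qed

lemma is_tree_iff_spanning_trees:
  "is_tree (V, E) \<longleftrightarrow> finite V \<and> V \<noteq> {} \<and> E \<in> spanning_trees V"
proof -
  have "finite_simple_graph (V, E) \<longleftrightarrow> finite V \<and> E \<subseteq> edges_on V"
    by (auto simp: finite_simple_graph_def edges_on_def)
  then show ?thesis
    using cycle_edge_redundant[of V E] redundant_edge_cycle[of E V]
    unfolding is_tree_def connected_graph_iff_links spanning_trees_def by blast
qed

section \<open>Labelled edges between cliques\<close>

text \<open>The families of sets arising as the sets of maximal cliques of \<open>k\<close>-trees.\<close>

inductive clique_family :: "nat \<Rightarrow> 'a set set \<Rightarrow> bool" for k :: nat where
  single: "card V = k + 1 \<Longrightarrow> clique_family k {V}"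
| extend: "\<lbrakk>clique_family k \<Q>; Q \<in> \<Q>; C \<subseteq> Q; card C = k; v \<notin> \<Union>\<Q>\<rbrakk> \<Longrightarrow>
     clique_family k (insert (insert v C) \<Q>)"

definition over :: "'a set set \<Rightarrow> 'a set \<Rightarrow> 'a set set" where
  "over \<Q> S = {Q\<in>\<Q>. S \<subseteq> Q}"

text \<open>Sets lying in a single member are included: the empty edge set is their only tree, so
  they contribute the factor 1.\<close>

definition faces :: "nat \<Rightarrow> 'a set set \<Rightarrow> 'a set set" where
  "faces k \<Q> = {S. card S = k \<and> over \<Q> S \<noteq> {}}"

definition face_edges :: "nat \<Rightarrow> 'a set set \<Rightarrow> 'a set set set" where
  "face_edges k \<Q> = {e \<in> edges_on \<Q>. card (\<Inter>e) = k}"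

definition labelled :: "'a set set set \<Rightarrow> 'a set \<Rightarrow> 'a set set set" where
  "labelled T S = {e\<in>T. \<Inter>e = S}"

lemma card_clique_family_member: "clique_family k \<Q> \<Longrightarrow> Q \<in> \<Q> \<Longrightarrow> card Q = k + 1"
proof (induction arbitrary: Q rule: clique_family.induct)
  case (extend \<Q> Q' C v)
  have "card Q' = k + 1"
    using extend by blast
  then have "finite Q'"
    using card.infinite by fastforce
  then have "finite C" "v \<notin> C"
    using extend.hyps finite_subset by auto
  then show ?case
    using extend by auto
qed simp

lemma finite_clique_family_member: "clique_family k \<Q> \<Longrightarrow> Q \<in> \<Q> \<Longrightarrow> finite Q"
  using card_clique_family_member[of k \<Q> Q] card.infinite[of Q] by fastforce

lemma finite_clique_family: "clique_family k \<Q> \<Longrightarrow> finite \<Q>"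
  by (induction rule: clique_family.induct) auto

lemma clique_family_nonempty: "clique_family k \<Q> \<Longrightarrow> \<Q> \<noteq> {}"
  by (induction rule: clique_family.induct) auto

lemma card_clique_family_Int_le:
  assumes "clique_family k \<Q>" "Q \<in> \<Q>" "Q' \<in> \<Q>" "Q \<noteq> Q'"
  shows "card (Q \<inter> Q') \<le> k"
proof -
  have fin: "finite Q" "finite Q'" and card: "card Q = k + 1" "card Q' = k + 1"
    using assms finite_clique_family_member card_clique_family_member by metis+
  have "\<not> Q \<subseteq> Q'"
    using card_subset_eq[of Q' Q] fin card assms(4) by auto
  then have "card (Q \<inter> Q') < card Q"
    using fin by (intro psubset_card_mono) auto
  then show ?thesis
    using card by simp
qed

lemma card_Inter_edge_le:
  assumes "clique_family k \<Q>" "e \<in> edges_on \<Q>"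
  shows "card (\<Inter>e) \<le> k"
proof -
  obtain Q Q' where "e = {Q, Q'}" "Q \<in> \<Q>" "Q' \<in> \<Q>" "Q \<noteq> Q'"
    using assms(2) edges_on_iff[of e] by blast
  then show ?thesis
    using card_clique_family_Int_le[OF assms(1), of Q Q'] by simp
qed

lemma clique_family_Int:
  assumes "clique_family k \<Q>" "Q \<in> \<Q>" "Q' \<in> \<Q>" "Q \<noteq> Q'" "S \<subseteq> Q" "S \<subseteq> Q'" "card S = k"
  shows "Q \<inter> Q' = S"
  using card_seteq[of "Q \<inter> Q'" S] card_clique_family_Int_le[OF assms(1-4)] assms
    finite_clique_family_member[OF assms(1,2)] by auto

text \<open>Distinct members share at most \<open>k\<close> elements, so a common face is their
  whole intersection. With \<open>face_edge_over\<close>, the edges labelled \<open>S\<close> are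
  thus all pairs of members over \<open>S\<close>.\<close>

lemma edges_on_over:
  assumes "clique_family k \<Q>" "S \<in> faces k \<Q>" "e \<in> edges_on (over \<Q> S)"
  shows "e \<in> face_edges k \<Q>" "\<Inter>e = S"
proof -
  obtain Q Q' where e: "e = {Q, Q'}" "Q \<in> over \<Q> S" "Q' \<in> over \<Q> S" "Q \<noteq> Q'"
    using assms(3) edges_on_iff[of e] by blast
  have S: "card S = k"
    using assms(2) by (simp add: faces_def)
  show "\<Inter>e = S"
    using e clique_family_Int[OF assms(1), of Q Q' S] S by (auto simp: over_def)
  moreover have "e \<in> edges_on \<Q>"
    using e by (auto simp: edges_on_iff over_def)
  ultimately show "e \<in> face_edges k \<Q>"
    using S by (simp add: face_edges_def)
qed

lemma face_edge_over:
  assumes "e \<in> face_edges k \<Q>"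
  shows "\<Inter>e \<in> faces k \<Q>" "e \<in> edges_on (over \<Q> (\<Inter>e))"
proof -
  obtain Q Q' where "e = {Q, Q'}" "Q \<in> \<Q>" "Q' \<in> \<Q>" "Q \<noteq> Q'"
    using assms edges_on_iff[of e] unfolding face_edges_def by blast
  then show "e \<in> edges_on (over \<Q> (\<Inter>e))"
    by (auto simp: edges_on_iff over_def)
  show "\<Inter>e \<in> faces k \<Q>"
    using assms \<open>e = {Q, Q'}\<close> \<open>Q \<in> \<Q>\<close> by (auto simp: faces_def face_edges_def over_def)
qed

lemma finite_faces:
  assumes "clique_family k \<Q>"
  shows "finite (faces k \<Q>)"
proof (rule finite_subset)
  show "faces k \<Q> \<subseteq> Pow (\<Union>\<Q>)"
    by (auto simp: faces_def over_def)
  show "finite (Pow (\<Union>\<Q>))"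
    using assms finite_clique_family finite_clique_family_member by blast
qed

text \<open>Since \<open>v\<close> is new, \<open>insert v C\<close> meets \<open>Q\<close> exactly
  in \<open>C\<close> and is attached to it by an edge labelled \<open>C\<close>.\<close>

lemma links_face_edges: "clique_family k \<Q> \<Longrightarrow> links \<Q> (face_edges k \<Q>)"
proof (induction rule: clique_family.induct)
  case (single V)
  then show ?case
    by (simp add: links_def)
next
  case (extend \<Q> Q C v)
  let ?q = "insert v C" and ?E = "face_edges k (insert (insert v C) \<Q>)"
  have "face_edges k \<Q> \<subseteq> ?E"
    by (auto simp: face_edges_def edges_on_def)
  then have old: "linked ?E P P'" if "P \<in> \<Q>" "P' \<in> \<Q>" for P P'
    using extend.IH that linked_mono unfolding links_def by metis
  have "?q \<inter> Q = C" "?q \<noteq> Q"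
    using extend.hyps by auto
  then have "{?q, Q} \<in> ?E"
    using extend.hyps(2,4) by (simp add: face_edges_def edges_on_def)
  then have "linked ?E ?q Q"
    by (rule linked_edge)
  then have "linked ?E P Q" if "P \<in> insert ?q \<Q>" for P
    using that old extend.hyps by auto
  then show ?case
    unfolding links_def using linked_trans linked_sym by metis
qed

text \<open>Collapsing everything hanging off a face \<open>S\<close> onto the cliques containing \<open>S\<close>. A walk
  between two such cliques is thereby turned into a walk using only edges with label \<open>S\<close>.\<close>

lemma clique_family_retraction:
  assumes "clique_family k \<Q>" "S \<in> faces k \<Q>"
  shows "\<exists>r. (\<forall>Q\<in>\<Q>. r Q \<in> over \<Q> S) \<and> (\<forall>Q\<in>over \<Q> S. r Q = Q) \<and>
    (\<forall>Q\<in>\<Q>. \<forall>Q'\<in>\<Q>. card (Q \<inter> Q') = k \<longrightarrow> Q \<inter> Q' \<noteq> S \<longrightarrow> r Q = r Q')"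
  using assms
proof (induction arbitrary: S rule: clique_family.induct)
  case (single V)
  then show ?case
    by (intro exI[of _ "\<lambda>Q. Q"]) (auto simp: over_def faces_def)
next
  case (extend \<Q> Q\<^sub>0 C v S)
  let ?q = "insert v C"
  have S: "card S = k"
    using extend.prems by (simp add: faces_def)
  have fam: "clique_family k (insert ?q \<Q>)"
    using extend.hyps clique_family.extend by metis
  have C: "v \<notin> C" "finite C"
    using extend.hyps finite_clique_family_member finite_subset by blast+
  have new: "Q \<inter> ?q = C" if "Q \<in> \<Q>" "card (Q \<inter> ?q) = k" for Q
  proof -
    have "Q \<inter> ?q \<subseteq> C"
      using that extend.hyps by auto
    then show ?thesis
      using card_subset_eq[OF C(2)] that extend.hyps by auto
  qed
  have q: "?q \<notin> \<Q>"
    using extend.hyps by auto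
  show ?case
  proof (cases "v \<in> S")
    case True
    \<comment> \<open>Only the new member contains \<open>v\<close>, so everything collapses onto
      it.\<close>
    then have "over (insert ?q \<Q>) S = {?q}"
      using extend.prems extend.hyps by (auto simp: over_def faces_def)
    then show ?thesis
      by (intro exI[of _ "\<lambda>_. ?q"]) auto
  next
    case False
    have "over \<Q> S \<noteq> {}"
    proof
      assume "over \<Q> S = {}"
      then have "S \<subseteq> ?q"
        using extend.prems by (auto simp: faces_def over_def)
      then have "S \<subseteq> C"
        using False by auto
      then show False
        using \<open>over \<Q> S = {}\<close> extend.hyps(2,3) unfolding over_def by blast
    qed
    then have "S \<in> faces k \<Q>"
      using S by (simp add: faces_def)
    from extend.IH[OF this] obtain r
      where r: "\<forall>Q\<in>\<Q>. r Q \<in> over \<Q> S" "\<forall>Q\<in>over \<Q> S. r Q = Q"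
        and edge: "\<forall>Q\<in>\<Q>. \<forall>Q'\<in>\<Q>. card (Q \<inter> Q') = k \<longrightarrow> Q \<inter> Q' \<noteq> S \<longrightarrow> r Q = r Q'"
      by (elim exE conjE) (rule that)
    \<comment> \<open>For \<open>S = C\<close> the new member lies over \<open>S\<close> and must be
      fixed. Otherwise its edge to \<open>Q\<^sub>0\<close>, labelled \<open>C\<close>, has to
      collapse.\<close>
    define r' where "r' = r(?q := if S = C then ?q else r Q\<^sub>0)"
    have old: "r' Q = r Q" if "Q \<in> \<Q>" for Q
      using that q by (auto simp: r'_def)
    have Sq: "S = C" if "S \<subseteq> ?q"
      using that False S extend.hyps(4) card_subset_eq[OF C(2), of S] by auto
    have range: "r' Q \<in> over (insert ?q \<Q>) S" if "Q \<in> insert ?q \<Q>" for Q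
      using that r(1) old extend.hyps(2) by (cases "Q = ?q") (auto simp: over_def r'_def)
    have fixed: "r' Q = Q" if "Q \<in> over (insert ?q \<Q>) S" for Q
      using that r(2) old Sq by (cases "Q = ?q") (auto simp: over_def r'_def)
    \<comment> \<open>Every edge at the new member has label \<open>C\<close>. Hence
      \<open>Q\<close> and \<open>Q\<^sub>0\<close> both contain \<open>C\<close>, and if they
      differ, \<open>r\<close> identifies them because their own edge has label \<open>C\<close>
      too.\<close>
    have newr: "r' Q = r' ?q" if Q: "Q \<in> \<Q>" "card (Q \<inter> ?q) = k" "Q \<inter> ?q \<noteq> S" for Q
    proof -
      have "C \<noteq> S" "C \<subseteq> Q"
        using new[OF Q(1,2)] Q(3) by auto
      have "r Q = r Q\<^sub>0"
      proof (cases "Q = Q\<^sub>0")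
        case False
        then have "Q \<inter> Q\<^sub>0 = C"
          using clique_family_Int[OF extend.hyps(1), of Q Q\<^sub>0 C] Q \<open>C \<subseteq> Q\<close> extend.hyps by blast
        then show ?thesis
          using edge Q(1) \<open>C \<noteq> S\<close> extend.hyps by auto
      qed simp
      then show ?thesis
        using old Q(1) \<open>C \<noteq> S\<close> by (simp add: r'_def)
    qed
    have edge': "r' Q = r' Q'" if "Q \<in> insert ?q \<Q>" "Q' \<in> insert ?q \<Q>"
      "card (Q \<inter> Q') = k" "Q \<inter> Q' \<noteq> S" for Q Q'
    proof (cases "Q = ?q"; cases "Q' = ?q")
      assume "Q = ?q" "Q' \<noteq> ?q"
      then show ?thesis
        using that newr[of Q'] by (simp add: Int_commute)
    next
      assume "Q \<noteq> ?q" "Q' = ?q"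
      then show ?thesis
        using that newr[of Q] by simp
    next
      assume "Q \<noteq> ?q" "Q' \<noteq> ?q"
      then show ?thesis
        using that edge old by simp
    qed simp
    show ?thesis
      by (rule exI[of _ r'], intro conjI ballI impI) (rule range fixed edge'; assumption)+
  qed
qed

section \<open>Splitting trees by edge labels\<close>

lemma links_iff_labelled_links:
  assumes fam: "clique_family k \<Q>" and T: "T \<subseteq> face_edges k \<Q>"
  shows "links \<Q> T \<longleftrightarrow> (\<forall>S\<in>faces k \<Q>. links (over \<Q> S) (labelled T S))"
proof (intro iffI ballI)
  fix S assume L: "links \<Q> T" and S: "S \<in> faces k \<Q>"
  obtain r where r: "\<forall>Q\<in>over \<Q> S. r Q = Q"
    and edge: "\<forall>Q\<in>\<Q>. \<forall>Q'\<in>\<Q>. card (Q \<inter> Q') = k \<longrightarrow> Q \<inter> Q' \<noteq> S \<longrightarrow> r Q = r Q'"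
    using clique_family_retraction[OF fam S] by (elim exE conjE) (rule that)
  \<comment> \<open>Edges labelled \<open>S\<close> are fixed by \<open>r\<close>; all others become
    stationary.\<close>
  have "linked (labelled T S) (r Q) (r Q')" if "{Q, Q'} \<in> T" for Q Q'
  proof -
    have QQ': "{Q, Q'} \<in> face_edges k \<Q>"
      using that T by auto
    then have *: "Q \<in> \<Q>" "Q' \<in> \<Q>" "card (Q \<inter> Q') = k"
      using edges_onD[of Q Q' \<Q>] by (auto simp: face_edges_def)
    show ?thesis
    proof (cases "Q \<inter> Q' = S")
      case True
      then have "r Q = Q" "r Q' = Q'"
        using r * by (auto simp: over_def)
      moreover have "{Q, Q'} \<in> labelled T S"
        using that True by (simp add: labelled_def)
      ultimately show ?thesis
        by (simp add: linked_edge)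
    next
      case False
      then show ?thesis
        using edge * by simp
    qed
  qed
  then have walk: "linked (labelled T S) (r Q) (r Q')" if "linked T Q Q'" for Q Q'
    using that linked_if_edges_linked by metis
  show "links (over \<Q> S) (labelled T S)"
    unfolding links_def
  proof (intro ballI)
    fix Q Q' assume Q: "Q \<in> over \<Q> S" "Q' \<in> over \<Q> S"
    then have "linked T Q Q'"
      using L by (auto simp: links_def over_def)
    then show "linked (labelled T S) Q Q'"
      using walk[of Q Q'] r Q by simp
  qed
next
  assume L: "\<forall>S\<in>faces k \<Q>. links (over \<Q> S) (labelled T S)"
  \<comment> \<open>Each face edge can be replaced by a walk among the edges of \<open>T\<close>
    with its label, and the face edges connect \<open>\<Q>\<close>.\<close>
  have "linked T Q Q'" if "{Q, Q'} \<in> face_edges k \<Q>" for Q Q'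
  proof -
    have "linked (labelled T (Q \<inter> Q')) Q Q'"
      using face_edge_over[OF that] edges_onD[of Q Q' "over \<Q> (Q \<inter> Q')"] L
      by (auto simp: links_def)
    then show ?thesis
      by (rule linked_mono) (auto simp: labelled_def)
  qed
  then show "links \<Q> T"
    using links_face_edges[OF fam] links_if_edges_linked by metis
qed

text \<open>Removing \<open>e\<close> affects only the part labelled \<open>\<Inter>e\<close>. So
  minimality, like connectedness, can be tested separately for each label.\<close>

lemma spanning_trees_iff_labelled:
  assumes fam: "clique_family k \<Q>" and T: "T \<subseteq> face_edges k \<Q>"
  shows "T \<in> spanning_trees \<Q> \<longleftrightarrow> (\<forall>S\<in>faces k \<Q>. labelled T S \<in> spanning_trees (over \<Q> S))"
proof -
  have "T \<subseteq> edges_on \<Q>"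
    using T by (auto simp: face_edges_def)
  have sub: "labelled T S \<subseteq> edges_on (over \<Q> S)" for S
    using T face_edge_over(2) by (fastforce simp: labelled_def)
  have remove: "labelled (T - {e}) S = labelled T S - {e}" for e S
    by (auto simp: labelled_def)
  have links_remove: "links \<Q> (T - {e}) \<longleftrightarrow>
      (\<forall>S\<in>faces k \<Q>. links (over \<Q> S) (labelled T S - {e}))" for e
    using links_iff_labelled_links[OF fam, of "T - {e}"] T unfolding remove by auto
  have other: "labelled T S - {e} = labelled T S" if "S \<noteq> \<Inter>e" for e S
    using that by (auto simp: labelled_def)
  have lab: "\<Inter>e \<in> faces k \<Q>" "e \<in> labelled T (\<Inter>e)" if "e \<in> T" for e
    using that T face_edge_over(1) by (auto simp: labelled_def)
  show ?thesis
  proof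
    assume "T \<in> spanning_trees \<Q>"
    then have L: "links \<Q> T" and M: "\<And>e. e \<in> T \<Longrightarrow> \<not> links \<Q> (T - {e})"
      by (auto simp: spanning_trees_def)
    have LS: "\<forall>S\<in>faces k \<Q>. links (over \<Q> S) (labelled T S)"
      using links_iff_labelled_links[OF fam T] L by blast
    have "\<not> links (over \<Q> S) (labelled T S - {e})" if "S \<in> faces k \<Q>" "e \<in> labelled T S" for S e
    proof
      assume "links (over \<Q> S) (labelled T S - {e})"
      moreover have e: "e \<in> T" "\<Inter>e = S"
        using that(2) by (auto simp: labelled_def)
      ultimately have "links (over \<Q> S') (labelled T S' - {e})" if "S' \<in> faces k \<Q>" for S'
        using LS that other[of S' e] by (cases "S' = S") auto
      then show False
        using M[OF e(1)] links_remove by blast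
    qed
    then show "\<forall>S\<in>faces k \<Q>. labelled T S \<in> spanning_trees (over \<Q> S)"
      using sub LS by (simp add: spanning_trees_def)
  next
    assume R: "\<forall>S\<in>faces k \<Q>. labelled T S \<in> spanning_trees (over \<Q> S)"
    then have "links \<Q> T"
      using links_iff_labelled_links[OF fam T] by (simp add: spanning_trees_def)
    moreover have "\<not> links \<Q> (T - {e})" if "e \<in> T" for e
      using R lab[OF that] unfolding links_remove spanning_trees_def by blast
    ultimately show "T \<in> spanning_trees \<Q>"
      using \<open>T \<subseteq> edges_on \<Q>\<close> by (simp add: spanning_trees_def)
  qed
qed

lemma card_face_spanning_trees:
  assumes fam: "clique_family k \<Q>"
  shows "card {T \<in> spanning_trees \<Q>. T \<subseteq> face_edges k \<Q>} =
    (\<Prod>S\<in>faces k \<Q>. card (over \<Q> S) ^ (card (over \<Q> S) - 2))"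
proof -
  let ?P = "Pi\<^sub>E (faces k \<Q>) (\<lambda>S. spanning_trees (over \<Q> S))"
  let ?\<T> = "{T \<in> spanning_trees \<Q>. T \<subseteq> face_edges k \<Q>}"
  have "bij_betw (\<lambda>T. restrict (labelled T) (faces k \<Q>)) ?\<T> ?P"
  \<comment> \<open>A family of trees is recovered from its union because the edges of the tree
    chosen for \<open>S\<close> all have label \<open>S\<close>.\<close>
  proof (rule bij_betw_byWitness[where f' = "\<lambda>p. \<Union>(p ` faces k \<Q>)"])
    show "\<forall>T\<in>?\<T>. \<Union>(restrict (labelled T) (faces k \<Q>) ` faces k \<Q>) = T"
      using face_edge_over(1) by (fastforce simp: labelled_def)
    have edges: "e \<in> face_edges k \<Q>" "\<Inter>e = S"
      if "p \<in> ?P" "S \<in> faces k \<Q>" "e \<in> p S" for p S e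
    proof -
      have "p S \<in> spanning_trees (over \<Q> S)"
        using PiE_mem[OF that(1,2)] .
      then have "e \<in> edges_on (over \<Q> S)"
        using that(3) by (auto simp: spanning_trees_def)
      then show "e \<in> face_edges k \<Q>" "\<Inter>e = S"
        using edges_on_over[OF fam that(2)] by auto
    qed
    have lab: "labelled (\<Union>(p ` faces k \<Q>)) S = p S" if "p \<in> ?P" "S \<in> faces k \<Q>" for p S
      using edges(2)[OF that(1)] that(2) by (auto simp: labelled_def)
    show "\<forall>p\<in>?P. restrict (labelled (\<Union>(p ` faces k \<Q>))) (faces k \<Q>) = p"
    proof
      fix p assume p: "p \<in> ?P"
      show "restrict (labelled (\<Union>(p ` faces k \<Q>))) (faces k \<Q>) = p"
      proof
        fix S
        show "restrict (labelled (\<Union>(p ` faces k \<Q>))) (faces k \<Q>) S = p S"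
          using lab[OF p, of S] PiE_arb[OF p, of S] by (cases "S \<in> faces k \<Q>") auto
      qed
    qed
    show "(\<lambda>T. restrict (labelled T) (faces k \<Q>)) ` ?\<T> \<subseteq> ?P"
      using spanning_trees_iff_labelled[OF fam] by auto
    show "(\<lambda>p. \<Union>(p ` faces k \<Q>)) ` ?P \<subseteq> ?\<T>"
    proof (rule image_subsetI)
      fix p assume p: "p \<in> ?P"
      have "\<Union>(p ` faces k \<Q>) \<subseteq> face_edges k \<Q>"
        using edges(1)[OF p] by blast
      moreover have "\<forall>S\<in>faces k \<Q>. labelled (\<Union>(p ` faces k \<Q>)) S \<in> spanning_trees (over \<Q> S)"
        using lab[OF p] PiE_mem[OF p] by simp
      ultimately show "\<Union>(p ` faces k \<Q>) \<in> ?\<T>"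
        using spanning_trees_iff_labelled[OF fam, of "\<Union>(p ` faces k \<Q>)"] by simp
    qed
  qed
  then have "card ?\<T> = card ?P"
    by (rule bij_betw_same_card)
  also have "\<dots> = (\<Prod>S\<in>faces k \<Q>. card (spanning_trees (over \<Q> S)))"
    using finite_faces[OF fam] by (rule card_PiE)
  also have "\<dots> = (\<Prod>S\<in>faces k \<Q>. card (over \<Q> S) ^ (card (over \<Q> S) - 2))"
    using finite_clique_family[OF fam]
    by (intro prod.cong Cayley_formula) (auto simp: faces_def over_def)
  finally show ?thesis .
qed

section \<open>Cliques and separators of k-trees\<close>

abbreviation attach :: "'a graph \<Rightarrow> 'a set \<Rightarrow> 'a \<Rightarrow> 'a graph" where
  "attach G C v \<equiv> (insert v (gverts G), gedges G \<union> {{u, v} |u. u \<in> C})"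

lemma adjacent_vertices:
  "finite_simple_graph G \<Longrightarrow> adjacent G x y \<Longrightarrow> x \<in> gverts G \<and> y \<in> gverts G \<and> x \<noteq> y"
  by (fastforce simp: finite_simple_graph_def adjacent_def)

lemma adjacent_attach:
  "adjacent (attach G C v) x y \<longleftrightarrow> adjacent G x y \<or> x = v \<and> y \<in> C \<or> y = v \<and> x \<in> C"
  by (auto simp: adjacent_def doubleton_eq_iff)

lemma is_clique_complete: "is_clique (complete_graph V) D \<longleftrightarrow> D \<subseteq> V"
  unfolding is_clique_def complete_graph_def adjacent_def by auto

lemma is_clique_attach:
  assumes "finite_simple_graph G" "is_clique G C" "v \<notin> gverts G"
  shows "is_clique (attach G C v) D \<longleftrightarrow>
    v \<notin> D \<and> is_clique G D \<or> v \<in> D \<and> D \<subseteq> insert v C"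
proof (cases "v \<in> D")
  case True
  have "D \<subseteq> insert v C" if D: "is_clique (attach G C v) D"
  proof
    fix u assume "u \<in> D"
    then have "u = v \<or> adjacent (attach G C v) u v"
      using D True unfolding is_clique_def by blast
    moreover have "\<not> adjacent G u v"
      using adjacent_vertices[OF assms(1)] assms(3) by blast
    ultimately show "u \<in> insert v C"
      unfolding adjacent_attach by blast
  qed
  moreover have "is_clique (attach G C v) D" if "D \<subseteq> insert v C"
    using that assms(2) unfolding is_clique_def adjacent_attach fst_conv by blast
  ultimately show ?thesis
    using True by blast
next
  case False
  then show ?thesis
    unfolding is_clique_def adjacent_attach fst_conv by blast
qed

lemma finite_clique: "finite_simple_graph G \<Longrightarrow> is_clique G D \<Longrightarrow> finite D"
  unfolding finite_simple_graph_def is_clique_def using finite_subset by blast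

text \<open>A clique through the new vertex lies in \<open>insert v C\<close>; any other is a clique
  of the old graph.\<close>

lemma k_tree_clique_extends:
  "k_tree k G \<Longrightarrow> is_clique G D \<Longrightarrow> \<exists>Q. is_clique G Q \<and> D \<subseteq> Q \<and> card Q = k + 1"
proof (induction arbitrary: D rule: k_tree.induct)
  case (complete V)
  then show ?case
    by (auto simp: is_clique_complete)
next
  case (extend G C v)
  note fsg = k_tree_finite_simple[OF extend.hyps(1)]
  have clique: "is_clique (attach G C v) X \<longleftrightarrow>
      v \<notin> X \<and> is_clique G X \<or> v \<in> X \<and> X \<subseteq> insert v C" for X
    using is_clique_attach[OF fsg extend.hyps(2,4)] .
  show ?case
  proof (cases "v \<in> D")
    case True
    have "v \<notin> C" "finite C"
      using extend.hyps finite_clique[OF fsg] by (auto simp: is_clique_def)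
    then have "card (insert v C) = k + 1"
      using extend.hyps by simp
    moreover have "D \<subseteq> insert v C"
      using True extend.prems clique by blast
    moreover have "is_clique (attach G C v) (insert v C)"
      using clique by blast
    ultimately show ?thesis
      by blast
  next
    case False
    then have "is_clique G D"
      using extend.prems clique by blast
    then obtain Q where Q: "is_clique G Q" "D \<subseteq> Q" "card Q = k + 1"
      using extend.IH by blast
    then have "v \<notin> Q"
      using extend.hyps(4) by (auto simp: is_clique_def)
    then show ?thesis
      using Q clique by blast
  qed
qed

lemma k_tree_maximal_clique_iff:
  assumes "k_tree k G"
  shows "maximal_clique G Q \<longleftrightarrow> is_clique G Q \<and> card Q = k + 1"
proof
  assume "maximal_clique G Q"
  then show "is_clique G Q \<and> card Q = k + 1"
    using k_tree_clique_extends[OF assms, of Q] unfolding maximal_clique_def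
    by (metis psubsetI)
next
  assume Q: "is_clique G Q \<and> card Q = k + 1"
  have "\<not> Q \<subset> C" if C: "is_clique G C" for C
  proof
    assume "Q \<subset> C"
    obtain Q' where Q': "is_clique G Q'" "C \<subseteq> Q'" "card Q' = k + 1"
      using k_tree_clique_extends[OF assms C] by blast
    then have "card Q < card Q'"
      using \<open>Q \<subset> C\<close> finite_clique[OF k_tree_finite_simple[OF assms]]
      by (intro psubset_card_mono) auto
    then show False
      using Q Q' by simp
  qed
  then show "maximal_clique G Q"
    using Q by (auto simp: maximal_clique_def)
qed

lemma k_tree_clique_family:
  assumes "k_tree k G"
  shows "clique_family k {Q. maximal_clique G Q}"
proof -
  have "clique_family k {Q. is_clique G Q \<and> card Q = k + 1}"
    using assms
  proof (induction rule: k_tree.induct)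
    case (complete V)
    then have "finite V"
      using card.infinite by fastforce
    then have "{Q. is_clique (complete_graph V) Q \<and> card Q = k + 1} = {V}"
      using complete card_subset_eq[of V] by (auto simp: is_clique_complete)
    then show ?case
      using clique_family.single complete by metis
  next
    case (extend G C v)
    let ?\<Q> = "{Q. is_clique G Q \<and> card Q = k + 1}"
    note fsg = k_tree_finite_simple[OF extend.hyps(1)]
    note clique = is_clique_attach[OF fsg extend.hyps(2,4)]
    have C: "v \<notin> C" "finite C"
      using extend.hyps finite_clique[OF fsg] by (auto simp: is_clique_def)
    then have card: "card (insert v C) = k + 1"
      using extend.hyps by simp
    have new: "Q = insert v C" if "Q \<subseteq> insert v C" "card Q = k + 1" for Q
      using card_subset_eq[of "insert v C" Q] that card C by auto
    have v: "v \<notin> Q" if "is_clique G Q" for Q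
      using that extend.hyps by (auto simp: is_clique_def)
    have "{Q. is_clique (attach G C v) Q \<and> card Q = k + 1} = insert (insert v C) ?\<Q>"
      unfolding clique using new card v by auto
    \<comment> \<open>The \<open>k\<close>-clique \<open>C\<close> need not be maximal in anything
      smaller; it is enlarged to provide the member required by
      \<open>clique_family.extend\<close>.\<close>
    moreover obtain Q where "Q \<in> ?\<Q>" "C \<subseteq> Q"
      using k_tree_clique_extends[OF extend.hyps(1,2)] by blast
    moreover have "v \<notin> \<Union>?\<Q>"
      using v by blast
    ultimately show ?case
      using clique_family.extend[OF extend.IH, of Q C v] extend.hyps(3) by simp
  qed
  then show ?thesis
    using k_tree_maximal_clique_iff[OF assms] by simp
qed

section \<open>Separation by common faces\<close>

text \<open>The set \<open>X\<close> certifies separation: a walk from \<open>a\<close> avoiding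
  \<open>S\<close> cannot leave it. Such a certificate is easily adjusted when a vertex is
  attached.\<close>

lemma k_tree_separation:
  assumes "k_tree k G" "card S = k" "is_clique G (insert a S)" "is_clique G (insert b S)"
    "a \<notin> S" "b \<notin> S" "a \<noteq> b"
  shows "\<exists>X\<subseteq>gverts G. a \<in> X \<and> b \<notin> X \<and> (\<forall>x\<in>X. \<forall>y. adjacent G x y \<longrightarrow> y \<notin> S \<longrightarrow> y \<in> X)"
  using assms
proof (induction arbitrary: S a b rule: k_tree.induct)
  case (complete V)
  have fV: "finite V"
    using complete.hyps card.infinite by fastforce
  have sub: "insert a S \<subseteq> V" "insert b S \<subseteq> V"
    using complete.prems by (auto simp: is_clique_complete)
  have "finite S"
    using sub(1) finite_subset[OF _ fV] by blast
  then have "insert a S = V" "insert b S = V"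
    using complete.hyps complete.prems(1,4,5)
    by (simp_all add: card_subset_eq[OF fV sub(1)] card_subset_eq[OF fV sub(2)])
  then show ?case
    using complete.prems by auto
next
  case (extend G C v)
  note fsg = k_tree_finite_simple[OF extend.hyps(1)]
  have new: "D \<subseteq> insert v C" if "is_clique (attach G C v) D" "v \<in> D" for D
    using that is_clique_attach[OF fsg extend.hyps(2,4), of D] by simp
  have old: "is_clique G D" if "is_clique (attach G C v) D" "v \<notin> D" for D
    using that is_clique_attach[OF fsg extend.hyps(2,4), of D] by simp
  have C: "v \<notin> C" "finite C" "C \<subseteq> gverts G"
    using extend.hyps finite_clique[OF fsg] by (auto simp: is_clique_def)
  have vnon: "\<not> adjacent G v y" "\<not> adjacent G y v" for y
    using adjacent_vertices[OF fsg] extend.hyps(4) by blast+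
  have verts: "a \<in> insert v (gverts G)" "b \<in> insert v (gverts G)"
    using extend.prems by (auto simp: is_clique_def)
  consider "v \<in> S" | "v \<notin> S" "a = v" | "v \<notin> S" "b = v" | "v \<notin> S" "a \<noteq> v" "b \<noteq> v"
    by blast
  then show ?case
  proof cases
    \<comment> \<open>Both cliques would equal \<open>insert v C\<close>, which forces
      \<open>a = b\<close>.\<close>
    case 1
    then have sub: "insert a S \<subseteq> insert v C" "insert b S \<subseteq> insert v C"
      using new[OF extend.prems(2)] new[OF extend.prems(3)] by auto
    have "finite S"
      using sub(1) C(2) finite_subset[of S "insert v C"] by simp
    then have "insert a S = insert v C" "insert b S = insert v C"
      using extend.prems(1,4,5) extend.hyps(3) C
      by (simp_all add: card_subset_eq[OF _ sub(1)] card_subset_eq[OF _ sub(2)])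
    then show ?thesis
      using extend.prems by blast
  next
    \<comment> \<open>Here \<open>S = C\<close> is the whole neighbourhood of \<open>v = a\<close>,
      so \<open>{v}\<close> serves.\<close>
    case 2
    then have "S \<subseteq> C"
      using new[OF extend.prems(2)] by auto
    from card_subset_eq[OF C(2) this] have "S = C"
      using extend.prems(1) extend.hyps(3) by simp
    then show ?thesis
      using 2 extend.prems vnon unfolding adjacent_attach
      by (intro exI[of _ "{v}"]) auto
  next
    \<comment> \<open>Here \<open>v = b\<close> has neighbourhood \<open>S\<close>, so all old
      vertices outside \<open>S\<close> serve.\<close>
    case 3
    then have "S \<subseteq> C"
      using new[OF extend.prems(3)] by auto
    from card_subset_eq[OF C(2) this] have "S = C"
      using extend.prems(1) extend.hyps(3) by simp
    then show ?thesis
      using 3 extend.prems extend.hyps(4) verts adjacent_vertices[OF fsg] unfolding adjacent_attach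
      by (intro exI[of _ "gverts G - S"]) auto
  next
    case 4
    then have "is_clique G (insert a S)" "is_clique G (insert b S)"
      using old[OF extend.prems(2)] old[OF extend.prems(3)] by auto
    from extend.IH[OF extend.prems(1) this extend.prems(4-6)] obtain X
      where X: "X \<subseteq> gverts G" "a \<in> X" "b \<notin> X"
        and closed: "\<forall>x\<in>X. \<forall>y. adjacent G x y \<longrightarrow> y \<notin> S \<longrightarrow> y \<in> X"
      by (elim exE conjE) (rule that)
    have "v \<notin> X"
      using X extend.hyps(4) by blast
    show ?thesis
    \<comment> \<open>If \<open>C\<close> meets \<open>X\<close>, then \<open>C - S\<close> lies in
      \<open>X\<close> because \<open>C\<close> is a clique, and \<open>v\<close> may be added;
      otherwise \<open>v\<close> has no neighbour in \<open>X\<close>.\<close>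
    proof (cases "C \<inter> X = {}")
      case True
      then show ?thesis
        using X closed \<open>v \<notin> X\<close> unfolding adjacent_attach
        by (intro exI[of _ X]) auto
    next
      case False
      then obtain c where c: "c \<in> C" "c \<in> X"
        by blast
      then have "y \<in> X" if "y \<in> C" "y \<notin> S" for y
        using that extend.hyps(2) closed unfolding is_clique_def by metis
      then show ?thesis
        using X closed vnon 4 unfolding adjacent_attach
        by (intro exI[of _ "insert v X"]) auto
    qed
  qed
qed

text \<open>The two cliques are \<open>insert a S\<close> and \<open>insert b S\<close>, and
  \<open>S\<close> separates \<open>a\<close> from \<open>b\<close>. A proper subset omits some
  \<open>s\<close> in \<open>S\<close> and leaves the path \<open>a\<close>, \<open>s\<close>,
  \<open>b\<close>.\<close>

lemma k_tree_minimal_vertex_separator: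
  assumes G: "k_tree k G" and S: "card S = k"
    and Q: "maximal_clique G Q" "S \<subseteq> Q" and Q': "maximal_clique G Q'" "S \<subseteq> Q'" and "Q \<noteq> Q'"
  shows "minimal_vertex_separator G S"
proof -
  note fsg = k_tree_finite_simple[OF G]
  have outside: "\<exists>a. a \<notin> S \<and> P = insert a S" if "maximal_clique G P" "S \<subseteq> P" for P
  proof -
    have P: "card P = k + 1" "finite P"
      using that k_tree_maximal_clique_iff[OF G] finite_clique[OF fsg] by auto
    then have "card (P - S) = 1"
      using that(2) S finite_subset by (subst card_Diff_subset) auto
    then obtain a where "P - S = {a}"
      by (auto simp: card_1_singleton_iff)
    then show ?thesis
      using that(2) by blast
  qed
  obtain a b where a: "a \<notin> S" "Q = insert a S" and b: "b \<notin> S" "Q' = insert b S"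
    using outside Q Q' by meson
  have clique: "is_clique G (insert a S)" "is_clique G (insert b S)"
    using Q Q' a b by (auto simp: maximal_clique_def)
  have "a \<noteq> b"
    using a b \<open>Q \<noteq> Q'\<close> by auto
  then obtain X where X: "a \<in> X" "b \<notin> X"
    and closed: "\<And>x y. x \<in> X \<Longrightarrow> adjacent G x y \<Longrightarrow> y \<notin> S \<Longrightarrow> y \<in> X"
    using k_tree_separation[OF G S clique a(1) b(1)] by blast
  have "\<not> adjacent G a b"
    using X closed b(1) by blast
  have verts: "S \<subseteq> gverts G" "a \<in> gverts G" "b \<in> gverts G"
    using clique by (auto simp: is_clique_def)
  have adj_del: "adjacent (delete_vertices G Y) x y \<longleftrightarrow> adjacent G x y \<and> x \<notin> Y \<and> y \<notin> Y" for Y x y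
    by (auto simp: adjacent_def delete_vertices_def)
  have "y \<in> X" if "(adjacent (delete_vertices G S))\<^sup>*\<^sup>* a y" for y
    using that by (induction rule: rtranclp_induct) (use X closed in \<open>auto simp: adj_del\<close>)
  then have sep: "separates G S a b"
    using verts X a(1) b(1) by (auto simp: separates_def same_component_def)
  have "\<not> separates G S' a b" if S': "S' \<subset> S" for S'
  proof -
    obtain s where s: "s \<in> S" "s \<notin> S'"
      using S' by blast
    have "a \<notin> S'" "b \<notin> S'"
      using S' a b by auto
    then have "adjacent (delete_vertices G S') a s" "adjacent (delete_vertices G S') s b"
      using s clique a(1) b(1) unfolding adj_del is_clique_def by auto
    then have "(adjacent (delete_vertices G S'))\<^sup>*\<^sup>* a b"
      by (meson r_into_rtranclp rtranclp.rtrancl_into_rtrancl)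
    then show ?thesis
      using verts \<open>a \<notin> S'\<close> \<open>b \<notin> S'\<close>
      by (auto simp: separates_def same_component_def delete_vertices_def)
  qed
  then show ?thesis
    unfolding minimal_vertex_separator_def
    using \<open>a \<noteq> b\<close> \<open>\<not> adjacent G a b\<close> sep by blast
qed

text \<open>Every edge of the clique-intersection graph has weight at most \<open>k\<close>, and some spanning
  tree only uses edges of weight \<open>k\<close>.\<close>

lemma k_tree_clique_tree_iff:
  fixes G :: "'a graph"
  assumes "k \<ge> 1" and G: "k_tree k G" and \<Q>: "\<Q> = {Q. maximal_clique G Q}"
  shows "clique_tree G (W, T) \<longleftrightarrow> W = \<Q> \<and> T \<in> spanning_trees \<Q> \<and> T \<subseteq> face_edges k \<Q>"
proof -
  have fam: "clique_family k \<Q>"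
    using k_tree_clique_family[OF G] \<Q> by simp
  have fin: "finite \<Q>" and ne: "\<Q> \<noteq> {}"
    using finite_clique_family[OF fam] clique_family_nonempty[OF fam] by auto
  let ?E = "gedges (clique_intersection_graph G)"
  have spanning: "is_spanning_tree (clique_intersection_graph G) (W, T) \<longleftrightarrow>
      W = \<Q> \<and> T \<in> spanning_trees \<Q> \<and> T \<subseteq> ?E" for W T
    using fin ne by (auto simp: is_spanning_tree_def is_tree_iff_spanning_trees
        clique_intersection_graph_def \<Q>)
  \<comment> \<open>By \<open>k \<ge> 1\<close>, intersections of size \<open>k\<close> are
    nonempty.\<close>
  have face: "face_edges k \<Q> \<subseteq> ?E"
  proof
    fix e assume e: "e \<in> face_edges k \<Q>"
    then obtain Q Q' where QQ': "e = {Q, Q'}" "Q \<in> \<Q>" "Q' \<in> \<Q>" "Q \<noteq> Q'"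
      using edges_on_iff[of e] unfolding face_edges_def by blast
    then have "Q \<inter> Q' \<noteq> {}"
      using e \<open>k \<ge> 1\<close> by (auto simp: face_edges_def)
    then show "e \<in> ?E"
      using QQ' by (auto simp: clique_intersection_graph_def \<Q>)
  qed
  have edges: "T \<subseteq> edges_on \<Q>" "finite T" "card T = card \<Q> - 1" if "T \<in> spanning_trees \<Q>" for T
    using that card_spanning_tree[OF fin ne] finite_edges_on[OF fin] finite_subset
    by (auto simp: spanning_trees_def)
  have upper: "total_weight (W, T) \<le> k * (card \<Q> - 1)" if "T \<in> spanning_trees \<Q>" for W T
    using sum_bounded_above[of T "\<lambda>e. card (\<Inter>e)" k] card_Inter_edge_le[OF fam] edges[OF that]
    by (auto simp: total_weight_def mult.commute)
  have max: "total_weight (W, T) = k * (card \<Q> - 1)"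
    if "T \<in> spanning_trees \<Q>" "T \<subseteq> face_edges k \<Q>" for W T
  proof -
    have "(\<Sum>e\<in>T. card (\<Inter>e)) = (\<Sum>e\<in>T. k)"
      using that(2) by (intro sum.cong) (auto simp: face_edges_def)
    then show ?thesis
      using edges(3)[OF that(1)] by (simp add: total_weight_def)
  qed
  \<comment> \<open>This tree attains the upper bound, so a maximum-weight tree cannot contain an
    edge of weight below \<open>k\<close>.\<close>
  obtain T\<^sub>0 where T\<^sub>0: "T\<^sub>0 \<in> spanning_trees \<Q>" "T\<^sub>0 \<subseteq> face_edges k \<Q>"
    using links_contains_spanning_tree[OF fin ne links_face_edges[OF fam]]
    by (auto simp: face_edges_def)
  show ?thesis
  proof
    assume ct: "clique_tree G (W, T)"
    then have WT: "W = \<Q>" "T \<in> spanning_trees \<Q>"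
      using spanning by (auto simp: clique_tree_def)
    have "is_spanning_tree (clique_intersection_graph G) (\<Q>, T\<^sub>0)"
      using spanning T\<^sub>0 face by blast
    then have weight: "k * (card \<Q> - 1) \<le> (\<Sum>e\<in>T. card (\<Inter>e))"
      using ct max[OF T\<^sub>0, of \<Q>] unfolding clique_tree_def total_weight_def by fastforce
    have "T \<subseteq> face_edges k \<Q>"
    proof (rule ccontr)
      assume "\<not> T \<subseteq> face_edges k \<Q>"
      then obtain e where "e \<in> T" "card (\<Inter>e) \<noteq> k"
        using edges(1)[OF WT(2)] by (auto simp: face_edges_def)
      then have "(\<Sum>e\<in>T. card (\<Inter>e)) < (\<Sum>e\<in>T. k)"
        using edges(1,2)[OF WT(2)] card_Inter_edge_le[OF fam]
        by (intro sum_strict_mono_ex1) (auto intro!: bexI[of _ e] simp: le_neq_implies_less subset_iff)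
      then show False
        using weight edges(3)[OF WT(2)] by (simp add: mult.commute)
    qed
    with WT show "W = \<Q> \<and> T \<in> spanning_trees \<Q> \<and> T \<subseteq> face_edges k \<Q>"
      by blast
  next
    assume *: "W = \<Q> \<and> T \<in> spanning_trees \<Q> \<and> T \<subseteq> face_edges k \<Q>"
    have "total_weight T' \<le> total_weight (W, T)"
      if "is_spanning_tree (clique_intersection_graph G) T'" for T'
      using that upper[of "snd T'" "fst T'"] max[of T W] spanning[of "fst T'" "snd T'"] * by simp
    then show "clique_tree G (W, T)"
      using * spanning face unfolding clique_tree_def by blast
  qed
qed

section \<open>Counting clique trees\<close>

theorem theorem9:
  fixes G :: "'a graph" and k :: nat
  assumes "k \<ge> 1" and "k_tree k G"
  shows "card {T. clique_tree G T} =
    (\<Prod>S | minimal_vertex_separator G S. (mvs_multiplicity G S + 1) ^ (mvs_multiplicity G S - 1))"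
proof -
  define \<Q> where "\<Q> = {Q. maximal_clique G Q}"
  have fam: "clique_family k \<Q>"
    using k_tree_clique_family[OF assms(2)] \<Q>_def by simp
  have fin: "finite \<Q>" and ne: "\<Q> \<noteq> {}"
    using finite_clique_family[OF fam] clique_family_nonempty[OF fam] by auto
  let ?\<T> = "{T \<in> spanning_trees \<Q>. T \<subseteq> face_edges k \<Q>}"
  note ct = k_tree_clique_tree_iff[OF assms \<Q>_def]
  have "{T. clique_tree G T} = Pair \<Q> ` ?\<T>"
    using ct by auto
  then have "card {T. clique_tree G T} = card ?\<T>"
    by (simp add: card_image inj_on_def)
  also have "\<dots> = (\<Prod>S\<in>faces k \<Q>. card (over \<Q> S) ^ (card (over \<Q> S) - 2))"
    using card_face_spanning_trees[OF fam] .
  also have "\<dots> = (\<Prod>S | minimal_vertex_separator G S.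
      (mvs_multiplicity G S + 1) ^ (mvs_multiplicity G S - 1))"
  proof -
    define T where "T = (SOME T. clique_tree G T)"
    have "\<exists>T. clique_tree G T"
      using links_contains_spanning_tree[OF fin ne links_face_edges[OF fam]] ct
      by (auto simp: face_edges_def)
    then have "clique_tree G T"
      unfolding T_def by (rule someI_ex)
    then have T: "gedges T \<in> spanning_trees \<Q>" "gedges T \<subseteq> face_edges k \<Q>"
      using ct[of "fst T" "snd T"] by auto
    have mult: "mvs_multiplicity G S = card (labelled (gedges T) S)" for S
      by (simp add: mvs_multiplicity_def labelled_def T_def)
    \<comment> \<open>The edges labelled \<open>S\<close> form a tree on the cliques over
      \<open>S\<close>, so their number is the same for every clique tree.\<close>
    have mult_face: "mvs_multiplicity G S = card (over \<Q> S) - 1" "card (over \<Q> S) > 0"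
      if S: "S \<in> faces k \<Q>" for S
    proof -
      have over: "finite (over \<Q> S)" "over \<Q> S \<noteq> {}"
        using S fin by (auto simp: faces_def over_def)
      have "labelled (gedges T) S \<in> spanning_trees (over \<Q> S)"
        using spanning_trees_iff_labelled[OF fam T(2)] T(1) S by blast
      then show "mvs_multiplicity G S = card (over \<Q> S) - 1"
        using card_spanning_tree[OF over] mult by simp
      show "card (over \<Q> S) > 0"
        using over by (simp add: card_gt_0_iff)
    qed
    have mult_nonface: "mvs_multiplicity G S = 0" if "S \<notin> faces k \<Q>" for S
    proof -
      have "labelled (gedges T) S = {}"
        using that T(2) face_edge_over(1)[of _ k \<Q>] by (auto simp: labelled_def)
      then show ?thesis
        by (simp add: mult)
    qed
    have sep: "minimal_vertex_separator G S"
      if S: "S \<in> faces k \<Q>" and two: "card (over \<Q> S) > 1" for S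
    proof -
      obtain Q Q' where "Q \<in> over \<Q> S" "Q' \<in> over \<Q> S" "Q \<noteq> Q'"
        using two by (metis card_le_Suc0_iff_eq card.infinite not_less One_nat_def zero_le)
      then show ?thesis
        using S k_tree_minimal_vertex_separator[OF assms(2), of S Q Q']
        by (auto simp: over_def faces_def \<Q>_def)
    qed
    have "finite {S. minimal_vertex_separator G S}"
    proof (rule finite_subset)
      show "{S. minimal_vertex_separator G S} \<subseteq> Pow (gverts G)"
        by (auto simp: minimal_vertex_separator_def separates_def)
      show "finite (Pow (gverts G))"
        using k_tree_finite_simple[OF assms(2)] by (simp add: finite_simple_graph_def)
    qed
    moreover have "card (over \<Q> S) ^ (card (over \<Q> S) - 2) =
        (mvs_multiplicity G S + 1) ^ (mvs_multiplicity G S - 1)" if "S \<in> faces k \<Q>" for S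
      using mult_face[OF that] by (simp add: numeral_2_eq_2)
    moreover have "card (over \<Q> S) = 1"
      if "S \<in> faces k \<Q>" "\<not> minimal_vertex_separator G S" for S
      using sep[OF that(1)] mult_face(2)[OF that(1)] that(2) by linarith
    ultimately show ?thesis
      using finite_faces[OF fam] mult_nonface
      \<comment> \<open>The index sets may differ only in factors 1: a face that is no separator
        lies in one clique, and a separator that is no face has multiplicity 0.\<close>
      by (intro prod.mono_neutral_cong) auto
  qed
  finally show ?thesis .
qed

end
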